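(* Let $W=\tau_1XY+\tau_2YX+\tau_3X+\tau_4Y+\tau_0\mathcal{I}$ with parameters $\tau_0,\dots,\tau_4$, and put $r=2-q-q^{-1}$. Then the operators $Y$ and $W$ satisfy the commutation relations $$[Y,[W,Y]]=e_1Y^3+rYWY+s_1Y^2+s_2\{Y,W\}+s_3W+s_4Y+s_5\mathcal{I},$$ $$[W,[Y,W]]=e_2YWY+e_3Y^3+e_4Y^2+rWYW+s_6W^2+s_7\{Y,W\}+s_8W+s_9Y+s_{10}\mathcal{I}$$ for certain constant coefficients $s_1,\dots,s_{10}$ (not given explicitly), where $$e_1=-\tau_4r,\qquad e_2=\tau_4(1-q^{-1})(q^3-1),\qquad e_3=-\tau_4^2(1+q^2)(1-q^{-1})^2,$$ $$e_4=\tau_4^2(abq+1)(2-q+q^2)+\tau_4(1+q+q^2)\big(\tau_0+q(\tau_1+\tau_2)(a+c+ac+ab)\big)+ac(q+1)(q^2+q+1)(q\tau_1+\tau_2)(\tau_1+q\tau_2).$$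
   Context: $q$ is the base parameter; $[A,B]=AB-BA$ and $\{A,B\}=AB+BA$. $T^{+}f(x)=f(qx)$, $T^{-}f(x)=f(x/q)$, and $\mathcal{I}$ is the identity operator. $X$ is multiplication by $x$, and $$Y=B(x)T^{+}+D(x)T^{-}-(B(x)+D(x))\mathcal{I},\quad B(x)=aq\,x^{-2}(x-1)(bx-c),\quad D(x)=x^{-2}(x-aq)(x-cq)$$ is the q-difference operator of the big q-Jacobi polynomials with parameters $a,b,c$. The algebra with these two relations is called the Heun-AW algebra of the big q-Jacobi type; the terms with coefficients $e_1,\dots,e_4$ are the extra terms that make it more general than the Askey-Wilson algebra.
   Formalization: The printed e₂ and e₄ are wrong (W=Y forces e₂+e₃+r=0, which the printed e₂ violates). Proved instead: e₂ has an extra factor q⁻¹; e₄ has an extra overall factor −(1−q⁻¹)², and 2−q+2q² replaces 2−q+q². *)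

theory Defs
  imports Complex_Main "HOL-Library.Function_Algebras"
begin

text \<open>
  Operators act on complex functions of a nonzero variable (the coefficients of the
  q-difference operator have poles at 0).  They are encoded on total functions and compared
  at nonzero arguments only; since the shifts preserve the set of nonzero points, the junk value
  at 0 never enters.  Sums and differences of operators are pointwise, the product is composition
  and powers are written \<open>A ^^ n\<close> (not \<open>A ^ n\<close>, which would be a pointwise power of functions).
\<close>

text \<open>
  The theorem corrects two of the published closed forms, which make the second relation fail for
  generic parameters, whatever the unspecified coefficients are.  Published:
  \<open>e\<^sub>2 = \<tau>\<^sub>4 (1 - 1/q)(q^3 - 1)\<close>, and \<open>e\<^sub>4\<close> without the factor \<open>- (1 - 1/q)^2\<close> and with
  \<open>2 - q + q^2\<close> instead of \<open>2 - q + 2 q^2\<close>.  For example, \<open>W = Y\<close> (\<open>\<tau>\<^sub>4 = 1\<close>, all other \<open>\<tau>\<close>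
  zero) forces \<open>e\<^sub>2 + e\<^sub>3 + r = 0\<close>, which needs the additional factor \<open>1/q\<close> in \<open>e\<^sub>2\<close>.
\<close>

type_synonym oper = "(complex \<Rightarrow> complex) \<Rightarrow> complex \<Rightarrow> complex"

definition op_eq :: "oper \<Rightarrow> oper \<Rightarrow> bool" (infix "\<doteq>" 50) where
  "A \<doteq> B \<longleftrightarrow> (\<forall>f x. x \<noteq> 0 \<longrightarrow> A f x = B f x)"

definition op_scale :: "complex \<Rightarrow> oper \<Rightarrow> oper" (infixr "\<cdot>" 75) where
  "k \<cdot> A = (\<lambda>f x. k * A f x)"

definition comm :: "oper \<Rightarrow> oper \<Rightarrow> oper" where
  "comm A B = (A \<circ> B) - (B \<circ> A)"

definition anticomm :: "oper \<Rightarrow> oper \<Rightarrow> oper" where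
  "anticomm A B = (A \<circ> B) + (B \<circ> A)"

definition shift_up :: "complex \<Rightarrow> oper" where
  "shift_up q f x = f (q * x)"

definition shift_down :: "complex \<Rightarrow> oper" where
  "shift_down q f x = f (x / q)"

definition mult_fun :: "(complex \<Rightarrow> complex) \<Rightarrow> oper" where
  "mult_fun g f x = g x * f x"

definition opX :: oper where
  "opX = mult_fun (\<lambda>x. x)"

definition coeffB :: "complex \<Rightarrow> complex \<Rightarrow> complex \<Rightarrow> complex \<Rightarrow> complex \<Rightarrow> complex" where
  "coeffB q a b c x = a * q * (x - 1) * (b * x - c) / x\<^sup>2"

definition coeffD :: "complex \<Rightarrow> complex \<Rightarrow> complex \<Rightarrow> complex \<Rightarrow> complex" where
  "coeffD q a c x = (x - a * q) * (x - c * q) / x\<^sup>2"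

definition big_q_Jacobi :: "complex \<Rightarrow> complex \<Rightarrow> complex \<Rightarrow> complex \<Rightarrow> oper" where
  "big_q_Jacobi q a b c =
     (mult_fun (coeffB q a b c) \<circ> shift_up q) + (mult_fun (coeffD q a c) \<circ> shift_down q)
     - mult_fun (\<lambda>x. coeffB q a b c x + coeffD q a c x)"

end

theory Submission
  imports Defs
begin

text \<open>
  Everything is a consequence of three relations between multiplication by \<open>x\<close>, here \<open>X\<close>, and the
  big q-Jacobi operator \<open>Y\<close>.  With \<open>\<kappa> = q + 1/q\<close> they express \<open>XXY - \<kappa> XYX + YXX\<close>,
  \<open>YYX - \<kappa> YXY + XYY\<close> and \<open>XYXY + YXYX - \<kappa> XYYX\<close> by words of lower degree.  The first two are
  the Askey-Wilson relations; the third one says that the Casimir element of the Askey-Wilson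
  algebra, which is central, acts as a scalar \<open>\<zeta>\<close>.

  The double commutator \<open>[Y,[W,Y]]\<close> differs from \<open>(2 - \<kappa>) YWY\<close> by \<open>-(YYW - \<kappa> YWY + WYY)\<close>, which
  is linear in \<open>W\<close>.  So the relation for \<open>YYX\<close> and its multiples by \<open>Y\<close> from the left and from the
  right suffice for the first formula (\<open>heun_YYW\<close>).

  Likewise \<open>[W,[Y,W]]\<close> amounts to \<open>WWY - \<kappa> WYW + YWW\<close>, which is quadratic in \<open>W\<close>.  For
  \<open>U = \<tau>\<^sub>1 XY + \<tau>\<^sub>2 YX + \<tau>\<^sub>3 X\<close> the terms in \<open>\<tau>\<^sub>1\<^sup>2\<close> and \<open>\<tau>\<^sub>2\<^sup>2\<close> are the Casimir relation multiplied by
  \<open>Y\<close> from the right and from the left; the terms in \<open>\<tau>\<^sub>1 \<tau>\<^sub>3\<close> and \<open>\<tau>\<^sub>2 \<tau>\<^sub>3\<close> are the Casimir relation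
  plus the relation for \<open>XXY\<close> multiplied by \<open>Y\<close>; the term in \<open>\<tau>\<^sub>3\<^sup>2\<close> is the relation for \<open>XXY\<close>.  Only
  the term in \<open>\<tau>\<^sub>1 \<tau>\<^sub>2\<close> needs work (\<open>mixed_degree_five\<close>).  The remainders combine into
  \<open>UU\<close>, \<open>UY + YU\<close>, \<open>U\<close>, \<open>YY\<close>, \<open>Y\<close> and a scalar, and the substitution \<open>U = W - \<tau>\<^sub>4 Y - \<tau>\<^sub>0\<close> gives the second
  formula (\<open>heun_WWY\<close>).

  For the big q-Jacobi operator, the three relations are checked by comparing the coefficients of the
  powers of the q-shift.
\<close>

section \<open>The Askey-Wilson relations\<close>

definition fscale :: "complex \<Rightarrow> (complex \<Rightarrow> complex) \<Rightarrow> complex \<Rightarrow> complex" (infixr "*\<^sub>f" 75) where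
  "k *\<^sub>f u = (\<lambda>x. k * u x)"

lemma fscale_apply: "(k *\<^sub>f u) x = k * u x"
  by (simp add: fscale_def)

text \<open>
  \<open>P\<close> plays the unit: \<open>X\<close> and \<open>Y\<close> live in the corner ring of operators \<open>A\<close> with \<open>PA = A = AP\<close>.  For the
  q-difference operators, \<open>P\<close> replaces the value at \<open>0\<close> by \<open>0\<close>.  The relations, which hold at nonzero
  points only, then become equalities of functions, so that operators may be applied to both sides.
  Each relation is used below for a chosen word, evaluated at a point \<open>x\<close>; this turns a noncommutative
  identity into a polynomial consequence of equations between complex numbers, with the
  values of the words at \<open>x\<close> as indeterminates.

  The assumption \<open>casimir\<close> fixes the value \<open>\<zeta>\<close> of the element
  \<open>XYXY + YXYX - \<kappa> XYYX - \<alpha> XYX - \<beta> (XY + YX) - (1 + \<kappa>) \<gamma> Y - \<eta> X\<close>, which commutes with \<open>X\<close> and \<open>Y\<close> by the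
  other two relations.
\<close>
locale askey_wilson =
  fixes X Y P :: oper and \<kappa> \<alpha> \<beta> \<gamma> \<rho> \<eta> \<zeta> :: complex
  assumes X_add: "X (u + v) = X u + X v" and X_scale: "X (k *\<^sub>f u) = k *\<^sub>f X u"
    and Y_add: "Y (u + v) = Y u + Y v" and Y_scale: "Y (k *\<^sub>f u) = k *\<^sub>f Y u"
    and P_add: "P (u + v) = P u + P v" and P_scale: "P (k *\<^sub>f u) = k *\<^sub>f P u"
    and X_P: "X (P u) = X u" and Y_P: "Y (P u) = Y u"
    and P_X: "P (X u) = X u" and P_Y: "P (Y u) = Y u" and P_P: "P (P u) = P u"
    and XXY: "X (X (Y u)) + Y (X (X u)) =
      \<kappa> *\<^sub>f X (Y (X u)) + \<alpha> *\<^sub>f X (X u) + \<beta> *\<^sub>f X u + \<gamma> *\<^sub>f P u"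
    and YYX: "Y (Y (X u)) + X (Y (Y u)) =
      \<kappa> *\<^sub>f Y (X (Y u)) + \<alpha> *\<^sub>f (X (Y u) + Y (X u)) + \<rho> *\<^sub>f X u + \<beta> *\<^sub>f Y u + \<eta> *\<^sub>f P u"
    and casimir: "X (Y (X (Y u))) + Y (X (Y (X u))) =
      \<kappa> *\<^sub>f X (Y (Y (X u))) + \<alpha> *\<^sub>f X (Y (X u)) + \<beta> *\<^sub>f (X (Y u) + Y (X u))
      + ((1 + \<kappa>) * \<gamma>) *\<^sub>f Y u + \<eta> *\<^sub>f X u + \<zeta> *\<^sub>f P u"
begin

lemmas lin = X_add X_scale Y_add Y_scale P_add P_scale X_P Y_P P_X P_Y P_P
lemmas apply_at = plus_fun_apply fscale_apply

lemma Y_diff: "Y (u - v) = Y u - Y v"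
  using Y_add[of "u - v" v] by simp

text \<open>
  The word \<open>XXYY\<close> can be reduced by the relation for \<open>XXY\<close> and by the one for \<open>XYY\<close>; comparing the two
  results yields this relation.
\<close>
lemma YXXY:
  "Y (X (X (Y u))) + \<alpha> *\<^sub>f X (Y (X u)) + \<rho> *\<^sub>f X (X u) + \<eta> *\<^sub>f X u = X (Y (Y (X u))) + \<gamma> *\<^sub>f Y u"
proof
  fix x
  note
    XXY[of "Y u", THEN fun_cong, of x, simplified lin apply_at]
    YYX[of u, THEN arg_cong[of _ _ X], THEN fun_cong, of x, simplified lin apply_at]
  then show "(Y (X (X (Y u))) + \<alpha> *\<^sub>f X (Y (X u)) + \<rho> *\<^sub>f X (X u) + \<eta> *\<^sub>f X u) x
      = (X (Y (Y (X u))) + \<gamma> *\<^sub>f Y u) x"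
    unfolding apply_at by algebra
qed

text \<open>
  This is the coefficient of \<open>\<tau>\<^sub>1 \<tau>\<^sub>2\<close> in the quadratic expression.  By \<open>YXXY\<close> and the relation for
  \<open>XXY\<close>, the left-hand side is \<open>2 \<kappa> YXYXY\<close> up to words of lower degree, which leaves
  \<open>\<kappa> (YXYXY - XYYYX)\<close> to be reduced.  Twice the bracket is, up to lower degree, the sum of the Casimir
  relation multiplied by \<open>Y\<close> from the left and from the right, once \<open>XYXYY\<close> and \<open>YYXYX\<close> are rewritten by
  the relation for \<open>YYX\<close>.
\<close>
lemma mixed_degree_five:
  "X (Y (Y (X (Y u)))) x + Y (X (Y (Y (X u)))) x + Y (X (X (Y (Y u)))) x + Y (Y (X (X (Y u)))) x =
   \<kappa> * (X (Y (Y (Y (X u)))) x + Y (X (Y (X (Y u)))) x)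
   + \<alpha> * (Y (X (X (Y u))) x + X (Y (Y (X u))) x)
   + \<beta> * (X (Y (Y u)) x + 2 * Y (X (Y u)) x + Y (Y (X u)) x)
   + \<kappa> * (1 + \<kappa>) * \<gamma> * Y (Y u) x
   + (\<kappa> * \<zeta> + (2 + \<kappa>) * \<alpha> * \<gamma> - \<beta>\<^sup>2) * Y u x
   + \<eta> * (X (Y u) x + Y (X u) x) + (\<rho> * \<gamma> + \<alpha> * \<zeta> - \<beta> * \<eta>) * P u x"
proof -
  note
    XXY[of u, THEN fun_cong, of x, simplified lin apply_at]
    YYX[of u, THEN fun_cong, of x, simplified lin apply_at]
    casimir[of u, THEN fun_cong, of x, simplified lin apply_at]
    YXXY[of u, THEN fun_cong, of x, simplified lin apply_at]
    XXY[of "Y u", THEN arg_cong[of _ _ Y], THEN fun_cong, of x, simplified lin apply_at]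
    casimir[of "Y u", THEN fun_cong, of x, simplified lin apply_at]
    casimir[of u, THEN arg_cong[of _ _ Y], THEN fun_cong, of x, simplified lin apply_at]
    YXXY[of "Y u", THEN fun_cong, of x, simplified lin apply_at]
    YXXY[of u, THEN arg_cong[of _ _ Y], THEN fun_cong, of x, simplified lin apply_at]
    YYX[of u, THEN arg_cong[of _ _ "\<lambda>v. X (Y v)"], THEN fun_cong, of x, simplified lin apply_at]
    YYX[of "Y (X u)", THEN fun_cong, of x, simplified lin apply_at]
  then show ?thesis by algebra
qed

lemma linear_part_lin:
  fixes U :: oper and t\<^sub>1 t\<^sub>2 t\<^sub>3 :: complex
  assumes U: "\<And>u. U u = t\<^sub>1 *\<^sub>f X (Y u) + t\<^sub>2 *\<^sub>f Y (X u) + t\<^sub>3 *\<^sub>f X u"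
  shows "U (u + v) = U u + U v" "U (k *\<^sub>f u) = k *\<^sub>f U u" "U (P u) = U u" "P (U u) = U u"
  unfolding U lin by (auto simp: fun_eq_iff fscale_def algebra_simps)

lemma linear_part_Y:
  fixes U :: oper and t\<^sub>1 t\<^sub>2 t\<^sub>3 :: complex
  assumes U: "\<And>u. U u = t\<^sub>1 *\<^sub>f X (Y u) + t\<^sub>2 *\<^sub>f Y (X u) + t\<^sub>3 *\<^sub>f X u"
  shows "Y (Y (U u)) x + U (Y (Y u)) x = \<kappa> * Y (U (Y u)) x + \<alpha> * (U (Y u) x + Y (U u) x)
    + \<rho> * U u x + \<beta> * (t\<^sub>1 + t\<^sub>2) * Y (Y u) x + (\<eta> * (t\<^sub>1 + t\<^sub>2) + \<beta> * t\<^sub>3) * Y u x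
    + \<eta> * t\<^sub>3 * P u x"
proof -
  note
    YYX[of u, THEN fun_cong, of x, simplified lin apply_at]
    YYX[of "Y u", THEN fun_cong, of x, simplified lin apply_at]
    YYX[of u, THEN arg_cong[of _ _ Y], THEN fun_cong, of x, simplified lin apply_at]
  then show ?thesis unfolding U lin apply_at by algebra
qed

lemma linear_part_square_Y:
  fixes U :: oper and t\<^sub>1 t\<^sub>2 t\<^sub>3 :: complex
  assumes U: "\<And>u. U u = t\<^sub>1 *\<^sub>f X (Y u) + t\<^sub>2 *\<^sub>f Y (X u) + t\<^sub>3 *\<^sub>f X u"
  shows "U (U (Y u)) x + Y (U (U u)) x = \<kappa> * U (Y (U u)) x + \<alpha> * U (U u) x
    + \<beta> * (t\<^sub>1 + t\<^sub>2) * (U (Y u) x + Y (U u) x)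
    + (\<beta> * t\<^sub>3 + \<eta> * (t\<^sub>1 + t\<^sub>2)) * U u x
    + (1 + \<kappa>) * \<gamma> * (t\<^sub>1\<^sup>2 + t\<^sub>2\<^sup>2 + \<kappa> * t\<^sub>1 * t\<^sub>2) * Y (Y u) x
    + (\<zeta> * (t\<^sub>1\<^sup>2 + t\<^sub>2\<^sup>2 + \<kappa> * t\<^sub>1 * t\<^sub>2) + t\<^sub>1 * t\<^sub>2 * ((2 + \<kappa>) * \<alpha> * \<gamma> - \<beta>\<^sup>2)
       + (t\<^sub>1 + t\<^sub>2) * t\<^sub>3 * (2 + \<kappa>) * \<gamma>) * Y u x
    + (t\<^sub>1 * t\<^sub>2 * (\<rho> * \<gamma> + \<alpha> * \<zeta> - \<beta> * \<eta>) + (t\<^sub>1 + t\<^sub>2) * t\<^sub>3 * \<zeta> + t\<^sub>3\<^sup>2 * \<gamma>) * P u x"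
proof -
  note
    mixed_degree_five[of u x]
    casimir[of "Y u", THEN fun_cong, of x, simplified lin apply_at]
    casimir[of u, THEN arg_cong[of _ _ Y], THEN fun_cong, of x, simplified lin apply_at]
    casimir[of u, THEN fun_cong, of x, simplified lin apply_at]
    XXY[of "Y u", THEN fun_cong, of x, simplified lin apply_at]
    XXY[of u, THEN arg_cong[of _ _ Y], THEN fun_cong, of x, simplified lin apply_at]
    XXY[of u, THEN fun_cong, of x, simplified lin apply_at]
  then show ?thesis unfolding U lin apply_at by algebra
qed

lemma heun_YYW:
  fixes W :: oper and t\<^sub>0 t\<^sub>1 t\<^sub>2 t\<^sub>3 t\<^sub>4 :: complex
  assumes W: "\<And>u. W u = t\<^sub>1 *\<^sub>f X (Y u) + t\<^sub>2 *\<^sub>f Y (X u) + t\<^sub>3 *\<^sub>f X u + t\<^sub>4 *\<^sub>f Y u + t\<^sub>0 *\<^sub>f P u"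
  shows "Y (Y (W u)) x + W (Y (Y u)) x = \<kappa> * Y (W (Y u)) x + (2 - \<kappa>) * t\<^sub>4 * Y (Y (Y u)) x
    + \<alpha> * (Y (W u) x + W (Y u) x) + \<rho> * W u x
    + ((2 - \<kappa>) * t\<^sub>0 - 2 * \<alpha> * t\<^sub>4 + \<beta> * (t\<^sub>1 + t\<^sub>2)) * Y (Y u) x
    + (\<eta> * (t\<^sub>1 + t\<^sub>2) + \<beta> * t\<^sub>3 - 2 * \<alpha> * t\<^sub>0 - \<rho> * t\<^sub>4) * Y u x
    + (\<eta> * t\<^sub>3 - \<rho> * t\<^sub>0) * P u x"
proof -
  define U :: oper where "U u = t\<^sub>1 *\<^sub>f X (Y u) + t\<^sub>2 *\<^sub>f Y (X u) + t\<^sub>3 *\<^sub>f X u" for u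
  note U = U_def
  have W': "W u = U u + t\<^sub>4 *\<^sub>f Y u + t\<^sub>0 *\<^sub>f P u" for u
    unfolding W U ..
  note lin = lin linear_part_lin[of U, OF U]
  show ?thesis
    using linear_part_Y[of U, OF U, of u x] unfolding W' lin apply_at by algebra
qed

text \<open>
  Since \<open>W\<close> is \<open>U + V\<close> with \<open>V\<close> a polynomial in \<open>Y\<close>, the mixed terms of degree one in \<open>U\<close> are combinations of
  \<open>YUY\<close> and \<open>UYY + YYU\<close>, where \<open>linear_part_Y\<close> applies.  The numbers \<open>h\<^sub>i\<close> are the coefficients of
  \<open>UY + YU\<close>, \<open>U\<close>, \<open>YY\<close>, \<open>Y\<close> and the unit before \<open>U\<close> is replaced by \<open>W - t\<^sub>4 Y - t\<^sub>0 P\<close>.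
\<close>
lemma heun_WWY:
  fixes W :: oper and t\<^sub>0 t\<^sub>1 t\<^sub>2 t\<^sub>3 t\<^sub>4 :: complex
  assumes W: "\<And>u. W u = t\<^sub>1 *\<^sub>f X (Y u) + t\<^sub>2 *\<^sub>f Y (X u) + t\<^sub>3 *\<^sub>f X u + t\<^sub>4 *\<^sub>f Y u + t\<^sub>0 *\<^sub>f P u"
  defines "m \<equiv> (2 - \<kappa>) * (1 + \<kappa>) * t\<^sub>4"
    and "h\<^sub>2 \<equiv> \<beta> * (t\<^sub>1 + t\<^sub>2) + (1 - \<kappa>) * \<alpha> * t\<^sub>4 + (2 - \<kappa>) * t\<^sub>0"
    and "h\<^sub>3 \<equiv> \<beta> * t\<^sub>3 + \<eta> * (t\<^sub>1 + t\<^sub>2) + (1 - \<kappa>) * \<rho> * t\<^sub>4"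
    and "h\<^sub>4 \<equiv> (1 + \<kappa>) * \<gamma> * (t\<^sub>1\<^sup>2 + t\<^sub>2\<^sup>2 + \<kappa> * t\<^sub>1 * t\<^sub>2)
      + (1 - \<kappa>) * \<beta> * (t\<^sub>1 + t\<^sub>2) * t\<^sub>4 + 2 * (2 - \<kappa>) * t\<^sub>0 * t\<^sub>4"
    and "h\<^sub>5 \<equiv> \<zeta> * (t\<^sub>1\<^sup>2 + t\<^sub>2\<^sup>2 + \<kappa> * t\<^sub>1 * t\<^sub>2) + t\<^sub>1 * t\<^sub>2 * ((2 + \<kappa>) * \<alpha> * \<gamma> - \<beta>\<^sup>2)
      + (t\<^sub>1 + t\<^sub>2) * t\<^sub>3 * (2 + \<kappa>) * \<gamma> + (1 - \<kappa>) * (\<eta> * (t\<^sub>1 + t\<^sub>2) + \<beta> * t\<^sub>3) * t\<^sub>4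
      + (2 - \<kappa>) * t\<^sub>0\<^sup>2"
    and "h\<^sub>6 \<equiv> t\<^sub>1 * t\<^sub>2 * (\<rho> * \<gamma> + \<alpha> * \<zeta> - \<beta> * \<eta>) + (t\<^sub>1 + t\<^sub>2) * t\<^sub>3 * \<zeta> + t\<^sub>3\<^sup>2 * \<gamma>
      + (1 - \<kappa>) * \<eta> * t\<^sub>3 * t\<^sub>4"
  shows "W (W (Y u)) x + Y (W (W u)) x = \<kappa> * W (Y (W u)) x + m * Y (W (Y u)) x
    + ((2 - \<kappa>) * t\<^sub>4\<^sup>2 - m * t\<^sub>4) * Y (Y (Y u)) x
    + \<alpha> * W (W u) x + (h\<^sub>2 - \<alpha> * t\<^sub>4) * (Y (W u) x + W (Y u) x) + (h\<^sub>3 - 2 * \<alpha> * t\<^sub>0) * W u x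
    + (h\<^sub>4 - m * t\<^sub>0 - 2 * h\<^sub>2 * t\<^sub>4 + \<alpha> * t\<^sub>4\<^sup>2) * Y (Y u) x
    + (h\<^sub>5 - 2 * h\<^sub>2 * t\<^sub>0 - h\<^sub>3 * t\<^sub>4 + 2 * \<alpha> * t\<^sub>0 * t\<^sub>4) * Y u x
    + (h\<^sub>6 - h\<^sub>3 * t\<^sub>0 + \<alpha> * t\<^sub>0\<^sup>2) * P u x"
proof -
  define U :: oper where "U u = t\<^sub>1 *\<^sub>f X (Y u) + t\<^sub>2 *\<^sub>f Y (X u) + t\<^sub>3 *\<^sub>f X u" for u
  note U = U_def
  have W': "W u = U u + t\<^sub>4 *\<^sub>f Y u + t\<^sub>0 *\<^sub>f P u" for u
    unfolding W U ..
  note lin = lin linear_part_lin[of U, OF U]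
  show ?thesis
    using linear_part_Y[of U, OF U, of u x] linear_part_square_Y[of U, OF U, of u x]
    unfolding W' lin apply_at m_def h\<^sub>2_def h\<^sub>3_def h\<^sub>4_def h\<^sub>5_def h\<^sub>6_def by algebra
qed

end

section \<open>The big q-Jacobi operator\<close>

text \<open>
  The structure constants are found by comparing the coefficients in the relations: \<open>-\<alpha>\<close>, \<open>-\<beta>\<close>,
  \<open>-\<gamma>\<close> are the coefficients of \<open>(2 - \<kappa>) x\<^sup>2 (B x + D x)\<close> as a polynomial in \<open>x\<close>, while \<open>\<rho>\<close>, \<open>\<eta>\<close> and
  \<open>\<zeta>\<close> come from the terms without a shift.
\<close>
locale big_q_Jacobi_setup =
  fixes q p a b c \<kappa> \<alpha> \<beta> \<gamma> \<rho> \<eta> \<zeta> :: complex and X Y :: oper and B D S :: "complex \<Rightarrow> complex"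
  assumes q: "q \<noteq> 0" and p: "p = inverse q"
    and X: "X = opX" and Y: "Y = big_q_Jacobi q a b c"
    and B: "B = coeffB q a b c" and D: "D = coeffD q a c" and S_def: "S = (\<lambda>x. B x + D x)"
    and \<kappa>: "\<kappa> = q + p"
    and \<alpha>: "\<alpha> = - (2 - \<kappa>) * (a * b * q + 1)"
    and \<beta>: "\<beta> = (2 - \<kappa>) * q * (a * b + a * c + a + c)"
    and \<gamma>: "\<gamma> = - (2 - \<kappa>) * a * c * q * (1 + q)"
    and \<rho>: "\<rho> = - (2 - \<kappa>) * (1 - a * b) * (1 - a * b * q\<^sup>2)"
    and \<eta>: "\<eta> = - (2 - \<kappa>) * q * (1 - a * b) * (q * a * (b + c) - (a + c))"
    and \<zeta>: "\<zeta> = - (2 - \<kappa>) * (q\<^sup>2 * (c\<^sup>2 + a\<^sup>2 + a\<^sup>2 * c\<^sup>2 + a\<^sup>2 * b\<^sup>2) + a * c * (1 + q\<^sup>2)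
      - q * (1 + q\<^sup>2) * (a * c\<^sup>2 + a * b * c + a\<^sup>2 * c + a\<^sup>2 * b) + q\<^sup>2 * (1 + q\<^sup>2) * a\<^sup>2 * b * c)"
begin

lemma pq: "p * q = 1"
  using q by (simp add: p)

lemma shift_inverse: "q * (p * x) = x" "p * (q * x) = x"
  using q by (simp_all add: p)

lemma \<kappa>q: "\<kappa> * q = q\<^sup>2 + 1" and \<kappa>p: "\<kappa> * p = p\<^sup>2 + 1"
  using pq unfolding \<kappa> by algebra+

lemma XY_apply:
  "X u x = x * u x"
  "Y u x = B x * u (q * x) + D x * u (p * x) - S x * u x"
  by (simp_all add: X Y B D S_def p big_q_Jacobi_def opX_def mult_fun_def shift_up_def
      shift_down_def divide_inverse mult.commute)

lemma at_0: "X u 0 = 0" "Y u 0 = 0"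
  by (simp_all add: XY_apply B D S_def coeffB_def coeffD_def)

lemma S_eq:
  assumes "x * w = 1"
  shows "S x = (a * b * q + 1) - q * (a * b + a * c + a + c) * w + a * c * q * (1 + q) * w\<^sup>2"
proof -
  have "x \<noteq> 0" and w: "w = inverse x"
    using assms by (auto simp: inverse_unique)
  have "S x = (a * q * (x - 1) * (b * x - c) + (x - a * q) * (x - c * q)) * w\<^sup>2"
    using \<open>x \<noteq> 0\<close> by (simp add: S_def B D coeffB_def coeffD_def w field_simps)
  then show ?thesis
    using assms by algebra
qed

text \<open>
  The coefficients of \<open>B x * u (q x)\<close> and \<open>D x * u (p x)\<close> in the relation for \<open>YYX\<close> (first two) and in the
  Casimir relation (last two).  Only the sum \<open>S\<close> enters, because a path with total shift \<open>1\<close> and at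
  most two applications of \<open>Y\<close> makes one step with a shift and otherwise stays in place.
\<close>
lemma shift_coeffs:
  assumes x: "x \<noteq> 0"
  shows "(q * x + x - \<kappa> * q * x) * S (q * x) + (q * x + x - \<kappa> * x) * S x = - (\<alpha> * (1 + q) * x + \<beta>)"
    and "(p * x + x - \<kappa> * p * x) * S (p * x) + (p * x + x - \<kappa> * x) * S x = - (\<alpha> * (1 + p) * x + \<beta>)"
    and "(1 + q) * x * (q * x * S (q * x) + x * S x) - \<kappa> * q * x\<^sup>2 * (S (q * x) + S x)
      = - (\<alpha> * q * x\<^sup>2 + \<beta> * (1 + q) * x + (1 + \<kappa>) * \<gamma>)"
    and "(1 + p) * x * (p * x * S (p * x) + x * S x) - \<kappa> * p * x\<^sup>2 * (S (p * x) + S x)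
      = - (\<alpha> * p * x\<^sup>2 + \<beta> * (1 + p) * x + (1 + \<kappa>) * \<gamma>)"
proof -
  define w where "w = inverse x"
  have w: "x * w = 1"
    using x by (simp add: w_def)
  have "q * x * (p * w) = 1" "p * x * (q * w) = 1"
    using w pq by algebra+
  note S = S_eq[OF w] this[THEN S_eq]
  show "(q * x + x - \<kappa> * q * x) * S (q * x) + (q * x + x - \<kappa> * x) * S x = - (\<alpha> * (1 + q) * x + \<beta>)"
    and "(p * x + x - \<kappa> * p * x) * S (p * x) + (p * x + x - \<kappa> * x) * S x = - (\<alpha> * (1 + p) * x + \<beta>)"
    and "(1 + q) * x * (q * x * S (q * x) + x * S x) - \<kappa> * q * x\<^sup>2 * (S (q * x) + S x)
      = - (\<alpha> * q * x\<^sup>2 + \<beta> * (1 + q) * x + (1 + \<kappa>) * \<gamma>)"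
    and "(1 + p) * x * (p * x * S (p * x) + x * S x) - \<kappa> * p * x\<^sup>2 * (S (p * x) + S x)
      = - (\<alpha> * p * x\<^sup>2 + \<beta> * (1 + p) * x + (1 + \<kappa>) * \<gamma>)"
    using pq w unfolding S \<alpha> \<beta> \<gamma> \<kappa> by algebra+
qed

text \<open>
  The coefficients of \<open>u x\<close>.  The products \<open>B x * D (q x)\<close> and \<open>D x * B (p x)\<close> come from moving one step
  up or down and back.
\<close>
lemma diagonal_coeffs:
  assumes x: "x \<noteq> 0"
  shows "B x * D (q * x) * (2 - \<kappa> * q) * x + D x * B (p * x) * (2 - \<kappa> * p) * x + (2 - \<kappa>) * (S x)\<^sup>2 * x
      = \<rho> * x + \<eta> - 2 * \<alpha> * x * S x - \<beta> * S x"
    and "x\<^sup>2 * (B x * D (q * x) * (2 * q - \<kappa>) + D x * B (p * x) * (2 * p - \<kappa>) + (2 - \<kappa>) * (S x)\<^sup>2)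
      = \<eta> * x + \<zeta> - \<alpha> * x\<^sup>2 * S x - 2 * \<beta> * x * S x - (1 + \<kappa>) * \<gamma> * S x"
proof -
  define w where "w = inverse x"
  have w: "w * x = 1"
    using x by (simp add: w_def)
  have coeffs: "B x = a * q * (x - 1) * (b * x - c) * w\<^sup>2" "D x = (x - a * q) * (x - c * q) * w\<^sup>2"
    "D (q * x) = (x - a) * (x - c) * w\<^sup>2" "B (p * x) = a * q * (x - q) * (b * x - c * q) * w\<^sup>2"
    using q x by (simp_all add: B D p coeffB_def coeffD_def w_def field_simps power2_eq_square)
  show "B x * D (q * x) * (2 - \<kappa> * q) * x + D x * B (p * x) * (2 - \<kappa> * p) * x + (2 - \<kappa>) * (S x)\<^sup>2 * x
      = \<rho> * x + \<eta> - 2 * \<alpha> * x * S x - \<beta> * S x"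
    using pq w unfolding S_def coeffs \<alpha> \<beta> \<gamma> \<rho> \<eta> \<kappa> by algebra
  show "x\<^sup>2 * (B x * D (q * x) * (2 * q - \<kappa>) + D x * B (p * x) * (2 * p - \<kappa>) + (2 - \<kappa>) * (S x)\<^sup>2)
      = \<eta> * x + \<zeta> - \<alpha> * x\<^sup>2 * S x - 2 * \<beta> * x * S x - (1 + \<kappa>) * \<gamma> * S x"
    using pq w unfolding S_def coeffs \<alpha> \<beta> \<gamma> \<eta> \<zeta> \<kappa> by algebra
qed

lemma XXY_at:
  assumes x: "x \<noteq> 0"
  shows "X (X (Y u)) x + Y (X (X u)) x =
    \<kappa> * X (Y (X u)) x + \<alpha> * X (X u) x + \<beta> * X u x + \<gamma> * u x"
proof -
  have "x * inverse x = 1"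
    using x by simp
  with S_eq[OF this] pq show ?thesis
    unfolding XY_apply \<alpha> \<beta> \<gamma> \<kappa> by algebra
qed

text \<open>
  In this relation and in the next one, the terms with the shifted arguments \<open>q\<^sup>2 x\<close> and \<open>p\<^sup>2 x\<close> cancel
  because \<open>q\<close> and \<open>p\<close> are the roots of \<open>t\<^sup>2 - \<kappa> t + 1\<close>.
\<close>
lemma YYX_at:
  assumes x: "x \<noteq> 0"
  shows "Y (Y (X u)) x + X (Y (Y u)) x =
    \<kappa> * Y (X (Y u)) x + \<alpha> * (X (Y u) x + Y (X u) x) + \<rho> * X u x + \<beta> * Y u x + \<eta> * u x"
proof -
  have "((Y (Y (X u)) x + X (Y (Y u)) x) - (\<kappa> * Y (X (Y u)) x + \<alpha> * (X (Y u) x + Y (X u) x) + \<rho> * X u x + \<beta> * Y u x + \<eta> * u x))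
    = - B x * u (q * x) * (((q * x + x - \<kappa> * q * x) * S (q * x) + (q * x + x - \<kappa> * x) * S x) - (- (\<alpha> * (1 + q) * x + \<beta>)))
      - D x * u (p * x) * (((p * x + x - \<kappa> * p * x) * S (p * x) + (p * x + x - \<kappa> * x) * S x) - (- (\<alpha> * (1 + p) * x + \<beta>)))
      + u x * ((B x * D (q * x) * (2 - \<kappa> * q) * x + D x * B (p * x) * (2 - \<kappa> * p) * x + (2 - \<kappa>) * (S x)\<^sup>2 * x) - (\<rho> * x + \<eta> - 2 * \<alpha> * x * S x - \<beta> * S x))"
    using \<kappa>q \<kappa>p unfolding XY_apply shift_inverse S_def by algebra
  also have "\<dots> = 0"
    using shift_coeffs(1,2)[OF x] diagonal_coeffs(1)[OF x] by simp
  finally show ?thesis by simp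
qed

lemma casimir_at:
  assumes x: "x \<noteq> 0"
  shows "X (Y (X (Y u))) x + Y (X (Y (X u))) x =
    \<kappa> * X (Y (Y (X u))) x + \<alpha> * X (Y (X u)) x + \<beta> * (X (Y u) x + Y (X u) x)
    + (1 + \<kappa>) * \<gamma> * Y u x + \<eta> * X u x + \<zeta> * u x"
proof -
  have "((X (Y (X (Y u))) x + Y (X (Y (X u))) x) - (\<kappa> * X (Y (Y (X u))) x + \<alpha> * X (Y (X u)) x + \<beta> * (X (Y u) x + Y (X u) x)
    + (1 + \<kappa>) * \<gamma> * Y u x + \<eta> * X u x + \<zeta> * u x))
    = - B x * u (q * x) * (((1 + q) * x * (q * x * S (q * x) + x * S x) - \<kappa> * q * x\<^sup>2 * (S (q * x) + S x)) - (- (\<alpha> * q * x\<^sup>2 + \<beta> * (1 + q) * x + (1 + \<kappa>) * \<gamma>)))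
      - D x * u (p * x) * (((1 + p) * x * (p * x * S (p * x) + x * S x) - \<kappa> * p * x\<^sup>2 * (S (p * x) + S x)) - (- (\<alpha> * p * x\<^sup>2 + \<beta> * (1 + p) * x + (1 + \<kappa>) * \<gamma>)))
      + u x * ((x\<^sup>2 * (B x * D (q * x) * (2 * q - \<kappa>) + D x * B (p * x) * (2 * p - \<kappa>) + (2 - \<kappa>) * (S x)\<^sup>2)) - (\<eta> * x + \<zeta> - \<alpha> * x\<^sup>2 * S x - 2 * \<beta> * x * S x - (1 + \<kappa>) * \<gamma> * S x))"
    using \<kappa>q \<kappa>p unfolding XY_apply shift_inverse S_def by algebra
  also have "\<dots> = 0"
    using shift_coeffs(3,4)[OF x] diagonal_coeffs(2)[OF x] by simp
  finally show ?thesis by simp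
qed

end

sublocale big_q_Jacobi_setup \<subseteq> askey_wilson X Y "\<lambda>u. u(0 := 0)" \<kappa> \<alpha> \<beta> \<gamma> \<rho> \<eta> \<zeta>
proof unfold_locales
  fix u v :: "complex \<Rightarrow> complex" and k
  show "X (X (Y u)) + Y (X (X u)) =
      \<kappa> *\<^sub>f X (Y (X u)) + \<alpha> *\<^sub>f X (X u) + \<beta> *\<^sub>f X u + \<gamma> *\<^sub>f u(0 := 0)"
  proof
    fix x show "(X (X (Y u)) + Y (X (X u))) x =
      (\<kappa> *\<^sub>f X (Y (X u)) + \<alpha> *\<^sub>f X (X u) + \<beta> *\<^sub>f X u + \<gamma> *\<^sub>f u(0 := 0)) x"
      using XXY_at[of x u] by (cases "x = 0") (simp_all add: at_0 fscale_def)
  qed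
  show "Y (Y (X u)) + X (Y (Y u)) =
      \<kappa> *\<^sub>f Y (X (Y u)) + \<alpha> *\<^sub>f (X (Y u) + Y (X u)) + \<rho> *\<^sub>f X u + \<beta> *\<^sub>f Y u + \<eta> *\<^sub>f u(0 := 0)"
  proof
    fix x show "(Y (Y (X u)) + X (Y (Y u))) x =
      (\<kappa> *\<^sub>f Y (X (Y u)) + \<alpha> *\<^sub>f (X (Y u) + Y (X u)) + \<rho> *\<^sub>f X u + \<beta> *\<^sub>f Y u + \<eta> *\<^sub>f u(0 := 0)) x"
      using YYX_at[of x u] by (cases "x = 0") (simp_all add: at_0 fscale_def)
  qed
  show "X (Y (X (Y u))) + Y (X (Y (X u))) =
      \<kappa> *\<^sub>f X (Y (Y (X u))) + \<alpha> *\<^sub>f X (Y (X u)) + \<beta> *\<^sub>f (X (Y u) + Y (X u))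
      + ((1 + \<kappa>) * \<gamma>) *\<^sub>f Y u + \<eta> *\<^sub>f X u + \<zeta> *\<^sub>f u(0 := 0)"
  proof
    fix x show "(X (Y (X (Y u))) + Y (X (Y (X u)))) x =
      (\<kappa> *\<^sub>f X (Y (Y (X u))) + \<alpha> *\<^sub>f X (Y (X u)) + \<beta> *\<^sub>f (X (Y u) + Y (X u))
      + ((1 + \<kappa>) * \<gamma>) *\<^sub>f Y u + \<eta> *\<^sub>f X u + \<zeta> *\<^sub>f u(0 := 0)) x"
      using casimir_at[of x u] by (cases "x = 0") (simp_all add: at_0 fscale_def)
  qed
  show "X (u(0 := 0)) = X u"
    by (simp add: fun_eq_iff XY_apply)
  show "Y (u(0 := 0)) = Y u"
  proof
    fix x show "Y (u(0 := 0)) x = Y u x"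
    proof (cases "x = 0")
      case False
      then show ?thesis using q by (simp add: XY_apply p)
    qed (simp add: at_0)
  qed
qed (auto simp: fun_eq_iff XY_apply S_def at_0 fscale_def algebra_simps)

section \<open>The commutation relations\<close>

lemma comm_apply: "comm A B u = A (B u) - B (A u)"
  by (simp add: comm_def)

lemma anticomm_apply: "anticomm A B u = A (B u) + B (A u)"
  by (simp add: anticomm_def)

theorem mainTheorem5:
  fixes q a b c \<tau>\<^sub>0 \<tau>\<^sub>1 \<tau>\<^sub>2 \<tau>\<^sub>3 \<tau>\<^sub>4 r e\<^sub>1 e\<^sub>2 e\<^sub>3 e\<^sub>4 :: complex
    and X Y W :: oper
  assumes q: "q \<noteq> 0"
    and X: "X = opX"
    and Y: "Y = big_q_Jacobi q a b c"
    and W: "W = \<tau>\<^sub>1 \<cdot> (X \<circ> Y) + \<tau>\<^sub>2 \<cdot> (Y \<circ> X) + \<tau>\<^sub>3 \<cdot> X + \<tau>\<^sub>4 \<cdot> Y + \<tau>\<^sub>0 \<cdot> id"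
    and r: "r = 2 - q - inverse q"
    and e1: "e\<^sub>1 = - \<tau>\<^sub>4 * r"
    and e2: "e\<^sub>2 = inverse q * (\<tau>\<^sub>4 * (1 - inverse q) * (q ^ 3 - 1))"
    and e3: "e\<^sub>3 = - \<tau>\<^sub>4\<^sup>2 * (1 + q\<^sup>2) * (1 - inverse q)\<^sup>2"
    and e4: "e\<^sub>4 = - (1 - inverse q)\<^sup>2 *
        (\<tau>\<^sub>4\<^sup>2 * (a * b * q + 1) * (2 - q + 2 * q\<^sup>2)
         + \<tau>\<^sub>4 * (1 + q + q\<^sup>2) * (\<tau>\<^sub>0 + q * (\<tau>\<^sub>1 + \<tau>\<^sub>2) * (a + c + a * c + a * b))
         + a * c * (q + 1) * (q\<^sup>2 + q + 1) * (q * \<tau>\<^sub>1 + \<tau>\<^sub>2) * (\<tau>\<^sub>1 + q * \<tau>\<^sub>2))"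
  shows "\<exists>s\<^sub>1 s\<^sub>2 s\<^sub>3 s\<^sub>4 s\<^sub>5 s\<^sub>6 s\<^sub>7 s\<^sub>8 s\<^sub>9 s\<^sub>1\<^sub>0 :: complex.
      comm Y (comm W Y) \<doteq>
        e\<^sub>1 \<cdot> (Y ^^ 3) + r \<cdot> (Y \<circ> W \<circ> Y) + s\<^sub>1 \<cdot> (Y ^^ 2) + s\<^sub>2 \<cdot> anticomm Y W
        + s\<^sub>3 \<cdot> W + s\<^sub>4 \<cdot> Y + s\<^sub>5 \<cdot> id
    \<and> comm W (comm Y W) \<doteq>
        e\<^sub>2 \<cdot> (Y \<circ> W \<circ> Y) + e\<^sub>3 \<cdot> (Y ^^ 3) + e\<^sub>4 \<cdot> (Y ^^ 2) + r \<cdot> (W \<circ> Y \<circ> W)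
        + s\<^sub>6 \<cdot> (W ^^ 2) + s\<^sub>7 \<cdot> anticomm Y W + s\<^sub>8 \<cdot> W + s\<^sub>9 \<cdot> Y + s\<^sub>1\<^sub>0 \<cdot> id"
proof -
  define p where "p = inverse q"
  define \<kappa> where "\<kappa> = q + p"
  define \<alpha> where "\<alpha> = - (2 - \<kappa>) * (a * b * q + 1)"
  define \<beta> where "\<beta> = (2 - \<kappa>) * q * (a * b + a * c + a + c)"
  define \<gamma> where "\<gamma> = - (2 - \<kappa>) * a * c * q * (1 + q)"
  define \<rho> where "\<rho> = - (2 - \<kappa>) * (1 - a * b) * (1 - a * b * q\<^sup>2)"
  define \<eta> where "\<eta> = - (2 - \<kappa>) * q * (1 - a * b) * (q * a * (b + c) - (a + c))"
  define \<zeta> where "\<zeta> = - (2 - \<kappa>) * (q\<^sup>2 * (c\<^sup>2 + a\<^sup>2 + a\<^sup>2 * c\<^sup>2 + a\<^sup>2 * b\<^sup>2) + a * c * (1 + q\<^sup>2)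
      - q * (1 + q\<^sup>2) * (a * c\<^sup>2 + a * b * c + a\<^sup>2 * c + a\<^sup>2 * b) + q\<^sup>2 * (1 + q\<^sup>2) * a\<^sup>2 * b * c)"
  interpret big_q_Jacobi_setup q p a b c \<kappa> \<alpha> \<beta> \<gamma> \<rho> \<eta> \<zeta> X Y
    "coeffB q a b c" "coeffD q a c" "\<lambda>x. coeffB q a b c x + coeffD q a c x"
    by unfold_locales (fact q p_def X Y refl \<kappa>_def \<alpha>_def \<beta>_def \<gamma>_def \<rho>_def \<eta>_def \<zeta>_def)+
  have r\<kappa>: "r = 2 - \<kappa>"
    by (simp add: r \<kappa>_def p_def)

  \<comment> \<open>\<open>W\<close> contains the true identity, whereas the abstract relations concern the operator built with the
    unit of the corner ring; the two agree away from \<open>0\<close>, and \<open>X\<close> and \<open>Y\<close> do not see the difference.\<close>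
  define V :: oper where "V u = \<tau>\<^sub>1 *\<^sub>f X (Y u) + \<tau>\<^sub>2 *\<^sub>f Y (X u) + \<tau>\<^sub>3 *\<^sub>f X u + \<tau>\<^sub>4 *\<^sub>f Y u + \<tau>\<^sub>0 *\<^sub>f u(0 := 0)" for u
  have WV: "W u x = V u x" if "x \<noteq> 0" for u x
    using that by (simp add: W V_def op_scale_def fscale_def)
  have cut: "(W u)(0 := 0) = V u" for u
  proof
    fix x show "((W u)(0 := 0)) x = V u x"
      by (cases "x = 0") (simp_all add: WV V_def at_0 fscale_def)
  qed
  have YW: "Y (W u) = Y (V u)" for u
    by (metis Y_P cut)
  have VW: "V (W u) = V (V u)" for u
    by (metis V_def X_P Y_P P_P cut)
  have V_diff: "V (u - v) = V u - V v" for u v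
  proof -
    have "V ((u - v) + v) = V (u - v) + V v"
      unfolding V_def lin by (auto simp: fun_eq_iff fscale_def algebra_simps)
    then show ?thesis by simp
  qed

  have rel1: "comm Y (comm W Y) \<doteq>
        e\<^sub>1 \<cdot> (Y ^^ 3) + r \<cdot> (Y \<circ> W \<circ> Y) + s\<^sub>1 \<cdot> (Y ^^ 2) + s\<^sub>2 \<cdot> anticomm Y W
        + s\<^sub>3 \<cdot> W + s\<^sub>4 \<cdot> Y + s\<^sub>5 \<cdot> id"
    if s: "s\<^sub>1 = - ((2 - \<kappa>) * \<tau>\<^sub>0 - 2 * \<alpha> * \<tau>\<^sub>4 + \<beta> * (\<tau>\<^sub>1 + \<tau>\<^sub>2))"
      "s\<^sub>2 = - \<alpha>" "s\<^sub>3 = - \<rho>"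
      "s\<^sub>4 = - (\<eta> * (\<tau>\<^sub>1 + \<tau>\<^sub>2) + \<beta> * \<tau>\<^sub>3 - 2 * \<alpha> * \<tau>\<^sub>0 - \<rho> * \<tau>\<^sub>4)"
      "s\<^sub>5 = - (\<eta> * \<tau>\<^sub>3 - \<rho> * \<tau>\<^sub>0)" for s\<^sub>1 s\<^sub>2 s\<^sub>3 s\<^sub>4 s\<^sub>5
    unfolding op_eq_def
  proof (intro allI impI)
    fix f and x :: complex
    assume x: "x \<noteq> 0"
    have "comm Y (comm W Y) f x = 2 * Y (V (Y f)) x - Y (Y (V f)) x - V (Y (Y f)) x"
      by (simp add: comm_apply Y_diff YW WV[OF x])
    moreover have "(e\<^sub>1 \<cdot> (Y ^^ 3) + r \<cdot> (Y \<circ> W \<circ> Y) + s\<^sub>1 \<cdot> (Y ^^ 2) + s\<^sub>2 \<cdot> anticomm Y W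
        + s\<^sub>3 \<cdot> W + s\<^sub>4 \<cdot> Y + s\<^sub>5 \<cdot> id) f x =
      e\<^sub>1 * Y (Y (Y f)) x + r * Y (V (Y f)) x + s\<^sub>1 * Y (Y f) x + s\<^sub>2 * (Y (V f) x + V (Y f) x)
        + s\<^sub>3 * V f x + s\<^sub>4 * Y f x + s\<^sub>5 * (f(0 := 0)) x"
      by (simp add: op_scale_def anticomm_apply YW WV[OF x] x eval_nat_numeral)
    ultimately show "comm Y (comm W Y) f x = (e\<^sub>1 \<cdot> (Y ^^ 3) + r \<cdot> (Y \<circ> W \<circ> Y) + s\<^sub>1 \<cdot> (Y ^^ 2)
        + s\<^sub>2 \<cdot> anticomm Y W + s\<^sub>3 \<cdot> W + s\<^sub>4 \<cdot> Y + s\<^sub>5 \<cdot> id) f x"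
      using heun_YYW[of V, OF V_def, of f x] unfolding s e1 r\<kappa> by algebra
  qed

  define m where "m = (2 - \<kappa>) * (1 + \<kappa>) * \<tau>\<^sub>4"
  define h\<^sub>2 where "h\<^sub>2 = \<beta> * (\<tau>\<^sub>1 + \<tau>\<^sub>2) + (1 - \<kappa>) * \<alpha> * \<tau>\<^sub>4 + (2 - \<kappa>) * \<tau>\<^sub>0"
  define h\<^sub>3 where "h\<^sub>3 = \<beta> * \<tau>\<^sub>3 + \<eta> * (\<tau>\<^sub>1 + \<tau>\<^sub>2) + (1 - \<kappa>) * \<rho> * \<tau>\<^sub>4"
  define h\<^sub>4 where "h\<^sub>4 = (1 + \<kappa>) * \<gamma> * (\<tau>\<^sub>1\<^sup>2 + \<tau>\<^sub>2\<^sup>2 + \<kappa> * \<tau>\<^sub>1 * \<tau>\<^sub>2)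
      + (1 - \<kappa>) * \<beta> * (\<tau>\<^sub>1 + \<tau>\<^sub>2) * \<tau>\<^sub>4 + 2 * (2 - \<kappa>) * \<tau>\<^sub>0 * \<tau>\<^sub>4"
  define h\<^sub>5 where "h\<^sub>5 = \<zeta> * (\<tau>\<^sub>1\<^sup>2 + \<tau>\<^sub>2\<^sup>2 + \<kappa> * \<tau>\<^sub>1 * \<tau>\<^sub>2) + \<tau>\<^sub>1 * \<tau>\<^sub>2 * ((2 + \<kappa>) * \<alpha> * \<gamma> - \<beta>\<^sup>2)
      + (\<tau>\<^sub>1 + \<tau>\<^sub>2) * \<tau>\<^sub>3 * (2 + \<kappa>) * \<gamma> + (1 - \<kappa>) * (\<eta> * (\<tau>\<^sub>1 + \<tau>\<^sub>2) + \<beta> * \<tau>\<^sub>3) * \<tau>\<^sub>4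
      + (2 - \<kappa>) * \<tau>\<^sub>0\<^sup>2"
  define h\<^sub>6 where "h\<^sub>6 = \<tau>\<^sub>1 * \<tau>\<^sub>2 * (\<rho> * \<gamma> + \<alpha> * \<zeta> - \<beta> * \<eta>) + (\<tau>\<^sub>1 + \<tau>\<^sub>2) * \<tau>\<^sub>3 * \<zeta> + \<tau>\<^sub>3\<^sup>2 * \<gamma>
      + (1 - \<kappa>) * \<eta> * \<tau>\<^sub>3 * \<tau>\<^sub>4"
  note square_rel = heun_WWY[of V, OF V_def, folded m_def h\<^sub>2_def h\<^sub>3_def h\<^sub>4_def h\<^sub>5_def h\<^sub>6_def]

  have e2': "e\<^sub>2 = - m"
    using pq unfolding e2 m_def \<kappa>_def p_def[symmetric] by algebra
  have e3': "e\<^sub>3 = - ((2 - \<kappa>) * \<tau>\<^sub>4\<^sup>2 - m * \<tau>\<^sub>4)"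
    using pq unfolding e3 m_def \<kappa>_def p_def[symmetric] by algebra
  have e4': "e\<^sub>4 = - (h\<^sub>4 - m * \<tau>\<^sub>0 - 2 * h\<^sub>2 * \<tau>\<^sub>4 + \<alpha> * \<tau>\<^sub>4\<^sup>2)"
    using pq unfolding e4 m_def h\<^sub>4_def h\<^sub>2_def \<alpha>_def \<beta>_def \<gamma>_def \<kappa>_def p_def[symmetric] by algebra

  have rel2: "comm W (comm Y W) \<doteq>
        e\<^sub>2 \<cdot> (Y \<circ> W \<circ> Y) + e\<^sub>3 \<cdot> (Y ^^ 3) + e\<^sub>4 \<cdot> (Y ^^ 2) + r \<cdot> (W \<circ> Y \<circ> W)
        + s\<^sub>6 \<cdot> (W ^^ 2) + s\<^sub>7 \<cdot> anticomm Y W + s\<^sub>8 \<cdot> W + s\<^sub>9 \<cdot> Y + s\<^sub>1\<^sub>0 \<cdot> id"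
    if s: "s\<^sub>6 = - \<alpha>" "s\<^sub>7 = - (h\<^sub>2 - \<alpha> * \<tau>\<^sub>4)" "s\<^sub>8 = - (h\<^sub>3 - 2 * \<alpha> * \<tau>\<^sub>0)"
      "s\<^sub>9 = - (h\<^sub>5 - 2 * h\<^sub>2 * \<tau>\<^sub>0 - h\<^sub>3 * \<tau>\<^sub>4 + 2 * \<alpha> * \<tau>\<^sub>0 * \<tau>\<^sub>4)"
      "s\<^sub>1\<^sub>0 = - (h\<^sub>6 - h\<^sub>3 * \<tau>\<^sub>0 + \<alpha> * \<tau>\<^sub>0\<^sup>2)" for s\<^sub>6 s\<^sub>7 s\<^sub>8 s\<^sub>9 s\<^sub>1\<^sub>0
    unfolding op_eq_def
  proof (intro allI impI)
    fix f and x :: complex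
    assume x: "x \<noteq> 0"
    have "comm W (comm Y W) f x = 2 * V (Y (V f)) x - V (V (Y f)) x - Y (V (V f)) x"
      by (simp add: comm_apply V_diff VW YW WV[OF x])
    moreover have "(e\<^sub>2 \<cdot> (Y \<circ> W \<circ> Y) + e\<^sub>3 \<cdot> (Y ^^ 3) + e\<^sub>4 \<cdot> (Y ^^ 2) + r \<cdot> (W \<circ> Y \<circ> W)
        + s\<^sub>6 \<cdot> (W ^^ 2) + s\<^sub>7 \<cdot> anticomm Y W + s\<^sub>8 \<cdot> W + s\<^sub>9 \<cdot> Y + s\<^sub>1\<^sub>0 \<cdot> id) f x =
      e\<^sub>2 * Y (V (Y f)) x + e\<^sub>3 * Y (Y (Y f)) x + e\<^sub>4 * Y (Y f) x + r * V (Y (V f)) x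
        + s\<^sub>6 * V (V f) x + s\<^sub>7 * (Y (V f) x + V (Y f) x) + s\<^sub>8 * V f x + s\<^sub>9 * Y f x
        + s\<^sub>1\<^sub>0 * (f(0 := 0)) x"
      by (simp add: op_scale_def anticomm_apply VW YW WV[OF x] x eval_nat_numeral)
    ultimately show "comm W (comm Y W) f x = (e\<^sub>2 \<cdot> (Y \<circ> W \<circ> Y) + e\<^sub>3 \<cdot> (Y ^^ 3) + e\<^sub>4 \<cdot> (Y ^^ 2)
        + r \<cdot> (W \<circ> Y \<circ> W) + s\<^sub>6 \<cdot> (W ^^ 2) + s\<^sub>7 \<cdot> anticomm Y W + s\<^sub>8 \<cdot> W + s\<^sub>9 \<cdot> Y
        + s\<^sub>1\<^sub>0 \<cdot> id) f x"
      using square_rel[of f x] unfolding s e2' e3' e4' r\<kappa> by algebra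
  qed

  show ?thesis
    by (intro exI conjI) (rule rel1[OF refl refl refl refl refl], rule rel2[OF refl refl refl refl refl])
qed

end
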